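(* Let $(G=(U\cup V,E),C,\mathrm{col},\ell)$ be an instance of \textsc{Max-Min Fair Matching} in which $G$ is a complete bipartite graph, with $n=|U|$, $k=|V|$, and $C=\{c_1,\dots,c_{|C|}\}$ ordered so that $|U_{c_i}|\ge|U_{c_{i+1}}|$ for all $i\in[1,|C|-1]$. Then the instance is a yes-instance if and only if $|U_{c_1}|\le \ell k+|U_{c_{|C|}}|$. With the non-emptiness constraint, the instance is a yes-instance if and only if it satisfies $|U_{c_1}|\le \ell k+|U_{c_{|C|}}|$ and additionally either ($\ell>0$ and $n\ge k$) or ($\ell=0$ and $|U_{c_1}|\ge k$).
   Context: For a bipartite graph $G=(U\cup V,E)$ with left side $U$ and right side $V$, a vertex $w$ and $M\subseteq E$, let $M(w)=\{w' \mid \{w,w'\}\in M\}$. A many-to-one matching is a set $M\subseteq E$ with $|M(u)|\le 1$ for every $u\in U$; it is left-perfect if $|M(u)|=1$ for every $u\in U$. Let $C$ be a finite set of colors and $\mathrm{col}\colon U\to C$; for $U'\subseteq U$ and $c\in C$ let $U'_c=\{u\in U'\mid \mathrm{col}(u)=c\}$. Define $\mathrm{MaxMin}(U')=\max_{c\in C}|U'_c|-\min_{c\in C}|U'_c|$ (over all colors of $C$). For an integer $\ell\ge0$, $U'$ is $\ell$-fair if $\mathrm{MaxMin}(U')\le\ell$, and $M$ is $\ell$-fair if $M(v)$ is $\ell$-fair for every $v\in V$. An instance $(G,C,\mathrm{col},\ell)$ of \textsc{Max-Min Fair Matching} is a yes-instance if there is an $\ell$-fair left-perfect many-to-one matching in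 $G$; with the non-emptiness constraint one additionally requires $M(v)\neq\emptyset$ for every $v\in V$.
   Formalization: The formal statement assumes that C is nonempty and that V is nonempty whenever U is; if V is empty, U is nonempty and all colors are equally frequent, the inequality holds but no left-perfect matching exists. *)

theory Defs
  imports Main
begin

text \<open>Edges are two-element vertex sets; both sides of the bipartition are sets of vertices of
  the same type.\<close>

definition bipartite_graph :: "'a set \<Rightarrow> 'a set \<Rightarrow> 'a set set \<Rightarrow> bool" where
  "bipartite_graph U V E \<longleftrightarrow>
     finite U \<and> finite V \<and> U \<inter> V = {} \<and> E \<subseteq> {{u, v} | u v. u \<in> U \<and> v \<in> V}"

definition complete_bipartite_graph :: "'a set \<Rightarrow> 'a set \<Rightarrow> 'a set set \<Rightarrow> bool" where
  "complete_bipartite_graph U V E \<longleftrightarrow>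
     bipartite_graph U V E \<and> (\<forall>u\<in>U. \<forall>v\<in>V. {u, v} \<in> E)"

definition partners :: "'a set set \<Rightarrow> 'a \<Rightarrow> 'a set" where
  "partners M w = {w'. {w, w'} \<in> M}"

definition many_to_one_matching :: "'a set \<Rightarrow> 'a set set \<Rightarrow> 'a set set \<Rightarrow> bool" where
  "many_to_one_matching U E M \<longleftrightarrow> M \<subseteq> E \<and> (\<forall>u\<in>U. card (partners M u) \<le> 1)"

definition left_perfect :: "'a set \<Rightarrow> 'a set set \<Rightarrow> bool" where
  "left_perfect U M \<longleftrightarrow> (\<forall>u\<in>U. card (partners M u) = 1)"

definition color_class :: "('a \<Rightarrow> 'c) \<Rightarrow> 'a set \<Rightarrow> 'c \<Rightarrow> 'a set" where
  "color_class col U' c = {u \<in> U'. col u = c}"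

text \<open>The maximum and minimum range over all of \<open>C\<close>, including colors not occurring in \<open>U'\<close>.
  They are only meaningful for finite nonempty \<open>C\<close>.\<close>

definition MaxMin :: "'c set \<Rightarrow> ('a \<Rightarrow> 'c) \<Rightarrow> 'a set \<Rightarrow> int" where
  "MaxMin C col U' =
     int (Max ((\<lambda>c. card (color_class col U' c)) ` C))
     - int (Min ((\<lambda>c. card (color_class col U' c)) ` C))"

definition fair_set :: "'c set \<Rightarrow> ('a \<Rightarrow> 'c) \<Rightarrow> nat \<Rightarrow> 'a set \<Rightarrow> bool" where
  "fair_set C col l U' \<longleftrightarrow> MaxMin C col U' \<le> int l"

definition fair_matching ::
    "'a set \<Rightarrow> 'c set \<Rightarrow> ('a \<Rightarrow> 'c) \<Rightarrow> nat \<Rightarrow> 'a set set \<Rightarrow> bool" where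
  "fair_matching V C col l M \<longleftrightarrow> (\<forall>v\<in>V. fair_set C col l (partners M v))"

definition mmfm_instance ::
    "'a set \<Rightarrow> 'a set \<Rightarrow> 'a set set \<Rightarrow> 'c set \<Rightarrow> ('a \<Rightarrow> 'c) \<Rightarrow> bool" where
  "mmfm_instance U V E C col \<longleftrightarrow> bipartite_graph U V E \<and> finite C \<and> col ` U \<subseteq> C"

definition mmfm_yes ::
    "'a set \<Rightarrow> 'a set \<Rightarrow> 'a set set \<Rightarrow> 'c set \<Rightarrow> ('a \<Rightarrow> 'c) \<Rightarrow> nat \<Rightarrow> bool" where
  "mmfm_yes U V E C col l \<longleftrightarrow>
     (\<exists>M. many_to_one_matching U E M \<and> left_perfect U M \<and> fair_matching V C col l M)"

definition mmfm_yes_nonempty ::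
    "'a set \<Rightarrow> 'a set \<Rightarrow> 'a set set \<Rightarrow> 'c set \<Rightarrow> ('a \<Rightarrow> 'c) \<Rightarrow> nat \<Rightarrow> bool" where
  "mmfm_yes_nonempty U V E C col l \<longleftrightarrow>
     (\<exists>M. many_to_one_matching U E M \<and> left_perfect U M \<and> fair_matching V C col l M
        \<and> (\<forall>v\<in>V. partners M v \<noteq> {}))"

end

theory Submission
  imports Defs
begin

text \<open>A left-perfect matching is a map \<open>f: U \<rightarrow> V\<close>. Summing the fairness inequality between the
  largest and the smallest color over all \<open>v\<close> gives necessity. For sufficiency, number each color
  class separately from 0 and send the \<open>i\<close>-th element to the vertex number \<open>i mod k\<close>: the count of
  a color at a vertex is then monotone in the class size, and at most \<open>\<ell>k\<close> extra consecutive
  indices add at most \<open>\<ell>\<close> to it. This map hits every vertex as soon as the largest class has at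
  least \<open>k\<close> elements. If it has fewer, and \<open>n \<ge> k\<close>, then some \<open>f\<close> is onto and injective on
  every color class, and this is fair for all \<open>\<ell> > 0\<close>.\<close>

section \<open>Fairness as a pairwise bound on color counts\<close>

lemma fair_set_iff:
  assumes "finite C" "C \<noteq> {}"
  shows "fair_set C col l S \<longleftrightarrow>
    (\<forall>c\<in>C. \<forall>d\<in>C. card (color_class col S c) \<le> card (color_class col S d) + l)"
    (is "_ \<longleftrightarrow> (\<forall>c\<in>C. \<forall>d\<in>C. ?g c \<le> ?g d + l)")
proof -
  have fin: "finite (?g ` C)" and ne: "?g ` C \<noteq> {}" using assms by auto
  \<comment> \<open>The integer difference becomes a comparison of naturals, so that counts can
    later be summed over \<open>V\<close> without subtraction.\<close>
  have "fair_set C col l S \<longleftrightarrow> Max (?g ` C) \<le> Min (?g ` C) + l"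
    unfolding fair_set_def MaxMin_def by linarith
  also have "\<dots> \<longleftrightarrow> (\<forall>c\<in>C. ?g c \<le> Min (?g ` C) + l)"
    using Max_le_iff[OF fin ne] by auto
  also have "\<dots> \<longleftrightarrow> (\<forall>c\<in>C. \<forall>d\<in>C. ?g c \<le> ?g d + l)"
  proof
    assume *: "\<forall>c\<in>C. ?g c \<le> Min (?g ` C) + l"
    show "\<forall>c\<in>C. \<forall>d\<in>C. ?g c \<le> ?g d + l"
    proof (intro ballI)
      fix c d assume "c \<in> C" "d \<in> C"
      moreover have "Min (?g ` C) \<le> ?g d" using fin \<open>d \<in> C\<close> by simp
      ultimately show "?g c \<le> ?g d + l" using * by force
    qed
  next
    assume *: "\<forall>c\<in>C. \<forall>d\<in>C. ?g c \<le> ?g d + l"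
    have "Min (?g ` C) \<in> ?g ` C" using fin ne by (rule Min_in)
    then show "\<forall>c\<in>C. ?g c \<le> Min (?g ` C) + l" using * by auto
  qed
  finally show ?thesis .
qed

section \<open>Matchings in complete bipartite graphs as maps\<close>

lemma matching_obtain_map:
  assumes "bipartite_graph U V E" "M \<subseteq> E" "left_perfect U M"
  obtains f where "f ` U \<subseteq> V" "\<And>v. v \<in> V \<Longrightarrow> partners M v = {u \<in> U. f u = v}"
proof -
  have disj: "U \<inter> V = {}" and E: "E \<subseteq> {{u, v} | u v. u \<in> U \<and> v \<in> V}"
    using assms(1) by (auto simp: bipartite_graph_def)
  \<comment> \<open>Edges are unordered, so \<open>{u, w}\<close> may be listed from either end;
    disjointness of \<open>U\<close> and \<open>V\<close> decides below which end is on the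
    left.\<close>
  have edge: "u \<in> U \<and> w \<in> V \<or> u \<in> V \<and> w \<in> U" if "{u, w} \<in> M" for u w
    using that assms(2) E by (fastforce simp: doubleton_eq_iff)
  have "\<forall>u\<in>U. \<exists>v. partners M u = {v}"
    using assms(3) by (auto simp: left_perfect_def card_1_singleton_iff)
  then obtain f where f: "\<And>u. u \<in> U \<Longrightarrow> partners M u = {f u}" by metis
  have mem: "{u, w} \<in> M \<longleftrightarrow> w = f u" if "u \<in> U" for u w
    using f[OF that] by (auto simp: partners_def)
  show thesis
  proof
    show "f ` U \<subseteq> V" using mem edge disj by blast
    show "partners M v = {u \<in> U. f u = v}" if "v \<in> V" for v
    proof -
      have "{v, u} \<in> M \<longleftrightarrow> u \<in> U \<and> f u = v" for u
      proof -
        have "{v, u} \<in> M \<Longrightarrow> u \<in> U" using edge[of v u] that disj by blast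
        then show ?thesis using mem[of u v] by (auto simp: insert_commute)
      qed
      then show ?thesis by (auto simp: partners_def)
    qed
  qed
qed

text \<open>This is where completeness enters: every edge \<open>{u, f u}\<close> is
  available.\<close>

lemma map_obtain_matching:
  assumes "complete_bipartite_graph U V E" "f ` U \<subseteq> V"
  obtains M where "many_to_one_matching U E M" "left_perfect U M"
    "\<And>v. v \<in> V \<Longrightarrow> partners M v = {u \<in> U. f u = v}"
proof
  let ?M = "(\<lambda>u. {u, f u}) ` U"
  have disj: "U \<inter> V = {}" and E: "\<And>u v. u \<in> U \<Longrightarrow> v \<in> V \<Longrightarrow> {u, v} \<in> E"
    using assms(1) by (auto simp: complete_bipartite_graph_def bipartite_graph_def)
  \<comment> \<open>Rules out \<open>u = f u'\<close> for \<open>u\<close> in \<open>U\<close>, so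
    an edge \<open>{u', f u'}\<close> containing \<open>u\<close> has \<open>u' = u\<close>.\<close>
  have fU: "f u \<notin> U" if "u \<in> U" for u using that disj assms(2) by blast
  have "partners ?M u = {f u}" if "u \<in> U" for u
    using that fU by (auto simp: partners_def doubleton_eq_iff)
  then have one: "card (partners ?M u) = 1" if "u \<in> U" for u using that by simp
  have "?M \<subseteq> E" using E assms(2) by auto
  then show "many_to_one_matching U E ?M" using one by (simp add: many_to_one_matching_def)
  show "left_perfect U ?M" using one by (simp add: left_perfect_def)
  show "partners ?M v = {u \<in> U. f u = v}" if "v \<in> V" for v
    using that disj assms(2) by (auto simp: partners_def doubleton_eq_iff)
qed

lemma mmfm_yes_iff_map:
  assumes "complete_bipartite_graph U V E"
  shows "mmfm_yes U V E C col l \<longleftrightarrow>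
    (\<exists>f. f ` U \<subseteq> V \<and> (\<forall>v\<in>V. fair_set C col l {u \<in> U. f u = v}))"
proof
  assume "mmfm_yes U V E C col l"
  then obtain M where M: "M \<subseteq> E" "left_perfect U M" "fair_matching V C col l M"
    by (auto simp: mmfm_yes_def many_to_one_matching_def)
  from assms have "bipartite_graph U V E" by (simp add: complete_bipartite_graph_def)
  then obtain f where "f ` U \<subseteq> V" "\<And>v. v \<in> V \<Longrightarrow> partners M v = {u \<in> U. f u = v}"
    using matching_obtain_map M(1,2) by metis
  with M(3) show "\<exists>f. f ` U \<subseteq> V \<and> (\<forall>v\<in>V. fair_set C col l {u \<in> U. f u = v})"
    by (auto simp: fair_matching_def)
next
  assume "\<exists>f. f ` U \<subseteq> V \<and> (\<forall>v\<in>V. fair_set C col l {u \<in> U. f u = v})"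
  then obtain f where f: "f ` U \<subseteq> V" "\<forall>v\<in>V. fair_set C col l {u \<in> U. f u = v}" by blast
  obtain M where "many_to_one_matching U E M" "left_perfect U M"
    "\<And>v. v \<in> V \<Longrightarrow> partners M v = {u \<in> U. f u = v}"
    using map_obtain_matching[OF assms f(1)] by blast
  with f(2) show "mmfm_yes U V E C col l" by (auto simp: mmfm_yes_def fair_matching_def)
qed

text \<open>The non-emptiness constraint says that no fiber over \<open>V\<close> is empty, hence an
  equality for the image of \<open>f\<close> in place of an inclusion.\<close>

lemma mmfm_yes_nonempty_iff_map:
  assumes "complete_bipartite_graph U V E"
  shows "mmfm_yes_nonempty U V E C col l \<longleftrightarrow>
    (\<exists>f. f ` U = V \<and> (\<forall>v\<in>V. fair_set C col l {u \<in> U. f u = v}))"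
proof
  assume "mmfm_yes_nonempty U V E C col l"
  then obtain M where M: "M \<subseteq> E" "left_perfect U M" "fair_matching V C col l M"
    "\<forall>v\<in>V. partners M v \<noteq> {}"
    by (auto simp: mmfm_yes_nonempty_def many_to_one_matching_def)
  from assms have "bipartite_graph U V E" by (simp add: complete_bipartite_graph_def)
  then obtain f where f: "f ` U \<subseteq> V" "\<And>v. v \<in> V \<Longrightarrow> partners M v = {u \<in> U. f u = v}"
    using matching_obtain_map M(1,2) by metis
  have "V \<subseteq> f ` U" using M(4) f(2) by fastforce
  with f M(3) show "\<exists>f. f ` U = V \<and> (\<forall>v\<in>V. fair_set C col l {u \<in> U. f u = v})"
    by (auto simp: fair_matching_def)
next
  assume "\<exists>f. f ` U = V \<and> (\<forall>v\<in>V. fair_set C col l {u \<in> U. f u = v})"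
  then obtain f where f: "f ` U = V" "\<forall>v\<in>V. fair_set C col l {u \<in> U. f u = v}" by blast
  obtain M where "many_to_one_matching U E M" "left_perfect U M"
    "\<And>v. v \<in> V \<Longrightarrow> partners M v = {u \<in> U. f u = v}"
    using map_obtain_matching[OF assms] f(1) by blast
  moreover from f(1) have "\<forall>v\<in>V. {u \<in> U. f u = v} \<noteq> {}" by blast
  ultimately show "mmfm_yes_nonempty U V E C col l"
    using f(2) unfolding mmfm_yes_nonempty_def fair_matching_def
    by (intro exI[of _ M]) simp
qed

section \<open>Counting, and the cyclic distribution of each color class\<close>

lemma card_color_class_eq_sum_fibers:
  assumes "finite U" "finite V" "f ` U \<subseteq> V"
  shows "card (color_class col U c) = (\<Sum>v\<in>V. card (color_class col {u \<in> U. f u = v} c))"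
proof -
  have "card (color_class col U c) = card (\<Union>v\<in>V. color_class col {u \<in> U. f u = v} c)"
    using assms(3) by (intro arg_cong[where f = card]) (auto simp: color_class_def)
  also have "\<dots> = (\<Sum>v\<in>V. card (color_class col {u \<in> U. f u = v} c))"
    using assms(1,2) by (intro card_UN_disjoint) (auto simp: color_class_def)
  finally show ?thesis .
qed

text \<open>Cut the indices from \<open>m\<close> up to \<open>a\<close> into blocks of length
  \<open>k\<close>: there are at most \<open>l\<close> blocks, each with at most one index of
  residue \<open>j\<close>.\<close>

lemma card_residue_class_lessThan_le:
  fixes a m l k j :: nat
  assumes "a \<le> l * k + m"
  shows "card {i. i < a \<and> i mod k = j} \<le> card {i. i < m \<and> i mod k = j} + l"
proof -
  have "card {i. m \<le> i \<and> i < a \<and> i mod k = j} \<le> card {..<l}"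
  proof (rule card_inj_on_le)
    \<comment> \<open>An index goes to the number of its block. Blocks are counted from
      \<open>m\<close> and not from 0, so that none is cut off at the start.\<close>
    show "inj_on (\<lambda>i. (i - m) div k) {i. m \<le> i \<and> i < a \<and> i mod k = j}"
    proof (rule inj_onI)
      have le: "x = y" if "m \<le> x" "x \<le> y" "x mod k = y mod k" "(x - m) div k = (y - m) div k"
        "0 < k" for x y
      proof -
        \<comment> \<open>Equal residues make the distance a multiple of \<open>k\<close>; a common
          block makes it less than \<open>k\<close>.\<close>
        have "k dvd y - x" using that mod_eq_dvd_iff_nat[of x y k] by simp
        moreover have "y - x < k"
        proof -
          have "y - m < k + (x - m) div k * k"
            using that(4,5) by (metis dividend_less_div_times)
          also have "\<dots> \<le> k + (x - m)" by simp
          finally show ?thesis using that by linarith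
        qed
        ultimately have "y - x = 0" by (meson nat_dvd_not_less neq0_conv)
        then show ?thesis using that by simp
      qed
      fix x y assume x: "x \<in> {i. m \<le> i \<and> i < a \<and> i mod k = j}"
        and y: "y \<in> {i. m \<le> i \<and> i < a \<and> i mod k = j}"
        and eq: "(x - m) div k = (y - m) div k"
      \<comment> \<open>For \<open>k = 0\<close> the hypothesis gives \<open>a \<le> m\<close>, and
        there is no such index.\<close>
      have "0 < k" using x assms by (cases k) auto
      then show "x = y" using x y eq le[of x y] le[of y x] by (cases "x \<le> y") auto
    qed
    show "(\<lambda>i. (i - m) div k) ` {i. m \<le> i \<and> i < a \<and> i mod k = j} \<subseteq> {..<l}"
      using assms by (auto intro!: less_mult_imp_div_less)
  qed simp
  moreover have "card {i. i < a \<and> i mod k = j} \<le>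
    card ({i. i < m \<and> i mod k = j} \<union> {i. m \<le> i \<and> i < a \<and> i mod k = j})"
    by (intro card_mono) auto
  moreover have "card ({i. i < m \<and> i mod k = j} \<union> {i. m \<le> i \<and> i < a \<and> i mod k = j}) \<le>
    card {i. i < m \<and> i mod k = j} + card {i. m \<le> i \<and> i < a \<and> i mod k = j}"
    by (rule card_Un_le)
  ultimately show ?thesis by simp
qed

text \<open>The numbering restarts at 0 in every class, while all colors share the numbering
  \<open>w\<close> of \<open>V\<close>. So the count at \<open>v\<close> depends only on the class
  size and on \<open>w v\<close>, which makes different colors comparable at each vertex.\<close>

lemma obtain_cyclic_map:
  assumes "finite U" "finite V" "V \<noteq> {}"
  obtains f w where "f ` U \<subseteq> V" "bij_betw w V {..<card V}"
    "\<And>v c. v \<in> V \<Longrightarrow> card (color_class col {u \<in> U. f u = v} c) =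
       card {i. i < card (color_class col U c) \<and> i mod card V = w v}"
proof -
  let ?k = "card V"
  have k: "0 < ?k" using assms by (simp add: card_gt_0_iff)
  obtain w where w: "bij_betw w V {..<?k}"
    using ex_bij_betw_finite_nat[OF assms(2)] by (auto simp: atLeast0LessThan)
  have "\<exists>h. bij_betw h (color_class col U c) {..<card (color_class col U c)}" for c
    using ex_bij_betw_finite_nat[of "color_class col U c"] assms(1)
    by (auto simp: atLeast0LessThan color_class_def)
  then obtain h where h: "\<And>c. bij_betw (h c) (color_class col U c) {..<card (color_class col U c)}"
    by metis
  define f where "f u = inv_into V w (h (col u) u mod ?k)" for u
  have fV: "f u \<in> V" and wf: "w (f u) = h (col u) u mod ?k" for u
    using w k by (auto simp: f_def bij_betw_def intro!: inv_into_into f_inv_into_f)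
  \<comment> \<open>Injectivity of \<open>w\<close> on \<open>V\<close> turns equality of vertices
    into equality of residues.\<close>
  have feq: "f u = v \<longleftrightarrow> h (col u) u mod ?k = w v" if "v \<in> V" for u v
    using that fV[of u] wf[of u] w by (auto simp: bij_betw_def inj_on_eq_iff)
  show thesis
  proof
    show "f ` U \<subseteq> V" using fV by auto
    show "bij_betw w V {..<?k}" by (rule w)
    fix v c assume v: "v \<in> V"
    have cc: "color_class col {u \<in> U. f u = v} c = {u \<in> color_class col U c. h c u mod ?k = w v}"
      using feq[OF v] by (auto simp: color_class_def)
    have surj: "h c ` color_class col U c = {..<card (color_class col U c)}"
      using h by (rule bij_betw_imp_surj_on)
    have "bij_betw (h c) (color_class col {u \<in> U. f u = v} c)
      {i. i < card (color_class col U c) \<and> i mod ?k = w v}"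
    proof (rule bij_betw_imageI)
      show "inj_on (h c) (color_class col {u \<in> U. f u = v} c)"
        unfolding cc using h[of c] by (auto simp: bij_betw_def intro: inj_on_subset)
      have "h c ` color_class col {u \<in> U. f u = v} c =
          {i \<in> h c ` color_class col U c. i mod ?k = w v}"
        unfolding cc by (rule Compr_image_eq[symmetric])
      also have "\<dots> = {i. i < card (color_class col U c) \<and> i mod ?k = w v}"
        unfolding surj by simp
      finally show "h c ` color_class col {u \<in> U. f u = v} c =
          {i. i < card (color_class col U c) \<and> i mod ?k = w v}" .
    qed
    then show "card (color_class col {u \<in> U. f u = v} c) =
       card {i. i < card (color_class col U c) \<and> i mod ?k = w v}"
      by (rule bij_betw_same_card)
  qed
qed

text \<open>The pairwise size bound is the hypothesis of the residue count, for each residue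
  \<open>w v\<close>. A single class of size at least \<open>card V\<close> already meets every
  residue, which gives surjectivity.\<close>

lemma obtain_cyclic_fair_map:
  assumes "finite U" "finite V" "V \<noteq> {}" "finite C" "C \<noteq> {}"
    and "\<And>c d. c \<in> C \<Longrightarrow> d \<in> C \<Longrightarrow>
      card (color_class col U c) \<le> l * card V + card (color_class col U d)"
  obtains f where "f ` U \<subseteq> V" "\<forall>v\<in>V. fair_set C col l {u \<in> U. f u = v}"
    "\<And>c. card V \<le> card (color_class col U c) \<Longrightarrow> f ` U = V"
proof -
  obtain f w where f: "f ` U \<subseteq> V" and w: "bij_betw w V {..<card V}"
    and cnt: "\<And>v c. v \<in> V \<Longrightarrow> card (color_class col {u \<in> U. f u = v} c) =
       card {i. i < card (color_class col U c) \<and> i mod card V = w v}"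
    using obtain_cyclic_map[OF assms(1-3)] by blast
  show thesis
  proof
    show "f ` U \<subseteq> V" by (rule f)
    show "\<forall>v\<in>V. fair_set C col l {u \<in> U. f u = v}"
      using assms(6) by (auto simp: fair_set_iff[OF assms(4,5)] cnt
        intro!: card_residue_class_lessThan_le)
    fix c assume c: "card V \<le> card (color_class col U c)"
    have "v \<in> f ` U" if v: "v \<in> V" for v
    proof -
      have "w v < card V" using v w by (auto simp: bij_betw_def)
      \<comment> \<open>The index \<open>w v\<close> is its own residue and lies below the class
        size.\<close>
      then have "w v \<in> {i. i < card (color_class col U c) \<and> i mod card V = w v}" using c by simp
      then have "card (color_class col {u \<in> U. f u = v} c) \<noteq> 0" using cnt[OF v] by auto
      then have "color_class col {u \<in> U. f u = v} c \<noteq> {}" by force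
      then show ?thesis by (auto simp: color_class_def)
    qed
    with f show "f ` U = V" by blast
  qed
qed

section \<open>Surjections that are injective on every color class\<close>

lemma inj_on_extend_finite:
  assumes "finite A" "finite V" "B \<subseteq> A" "inj_on g B" "g ` B \<subseteq> V" "card A \<le> card V"
  obtains h where "inj_on h A" "h ` A \<subseteq> V" "\<And>x. x \<in> B \<Longrightarrow> h x = g x"
proof -
  have "card (A - B) = card A - card B"
    using assms by (simp add: card_Diff_subset finite_subset)
  moreover have "card (V - g ` B) = card V - card B"
    using assms by (simp add: card_Diff_subset finite_subset card_image)
  ultimately have "card (A - B) \<le> card (V - g ` B)" using assms(6) by simp
  then obtain e where e: "e ` (A - B) \<subseteq> V - g ` B" "inj_on e (A - B)"
    using card_le_inj[of "A - B" "V - g ` B"] assms by auto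
  define h where "h x = (if x \<in> B then g x else e x)" for x
  show thesis
  proof
    have "inj_on h (B \<union> (A - B))"
      unfolding inj_on_Un using assms(4) e by (auto simp: h_def inj_on_def)
    moreover have "B \<union> (A - B) = A" using assms(3) by blast
    ultimately show "inj_on h A" by simp
    show "h ` A \<subseteq> V" using assms(5) e by (auto simp: h_def)
    show "h x = g x" if "x \<in> B" for x using that by (simp add: h_def)
  qed
qed

text \<open>A bijection from some \<open>W\<close> of size \<open>card V\<close> onto
  \<open>V\<close> secures surjectivity. It is extended within each class separately, since elements
  of different colors may share a vertex.\<close>

lemma obtain_surj_inj_on_color_classes:
  assumes "finite U" "finite V" "card V \<le> card U"
    and "\<And>c. card (color_class col U c) \<le> card V"
  obtains f where "f ` U = V" "\<And>c. inj_on f (color_class col U c)"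
proof -
  obtain W where W: "W \<subseteq> U" "card W = card V" using obtain_subset_with_card_n assms(3) by metis
  then have "finite W" using assms(1) finite_subset by blast
  then obtain g where g: "bij_betw g W V"
    using finite_same_card_bij[OF _ assms(2) W(2)] by blast
  have "\<exists>h. inj_on h (color_class col U c) \<and> h ` color_class col U c \<subseteq> V \<and>
    (\<forall>x\<in>color_class col W c. h x = g x)" for c
  proof -
    have fin: "finite (color_class col U c)" using assms(1) by (simp add: color_class_def)
    have sub: "color_class col W c \<subseteq> color_class col U c" using W by (auto simp: color_class_def)
    have inj: "inj_on g (color_class col W c)" and im: "g ` color_class col W c \<subseteq> V"
      using g by (auto simp: color_class_def bij_betw_def inj_on_def)
    obtain h where "inj_on h (color_class col U c)" "h ` color_class col U c \<subseteq> V"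
      "\<And>x. x \<in> color_class col W c \<Longrightarrow> h x = g x"
      using inj_on_extend_finite[OF fin assms(2) sub inj im assms(4)] by blast
    then show ?thesis by blast
  qed
  then obtain h where h: "\<And>c. inj_on (h c) (color_class col U c)"
    "\<And>c. h c ` color_class col U c \<subseteq> V"
    "\<And>c x. x \<in> color_class col W c \<Longrightarrow> h c x = g x" by metis
  show thesis
  proof
    let ?f = "\<lambda>u. h (col u) u"
    show "inj_on ?f (color_class col U c)" for c
      using h(1)[of c] by (auto simp: inj_on_def color_class_def)
    \<comment> \<open>All \<open>h c\<close> extend the same \<open>g\<close>, so gluing them keeps
      \<open>g\<close> on \<open>W\<close>, whatever the colors there.\<close>
    have fg: "?f x = g x" if "x \<in> W" for x using that h(3) by (simp add: color_class_def)
    have "?f ` U \<subseteq> V" using h(2) by (fastforce simp: color_class_def)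
    moreover have "?f ` W = V" using fg g by (simp add: bij_betw_def)
    ultimately show "?f ` U = V" using W by blast
  qed
qed

section \<open>Necessity of the conditions\<close>

lemma fair_map_imp_card_bound:
  assumes "finite U" "finite V" "finite C" "f ` U \<subseteq> V"
    and "\<forall>v\<in>V. fair_set C col l {u \<in> U. f u = v}" "c \<in> C" "d \<in> C"
  shows "card (color_class col U c) \<le> l * card V + card (color_class col U d)"
proof -
  have "C \<noteq> {}" using assms(6) by blast
  let ?g = "\<lambda>c v. card (color_class col {u \<in> U. f u = v} c)"
  \<comment> \<open>Summing the slack \<open>l\<close> over \<open>V\<close> yields the term
    \<open>l * card V\<close>.\<close>
  have "(\<Sum>v\<in>V. ?g c v) \<le> (\<Sum>v\<in>V. ?g d v + l)"
    using assms(5-7) fair_set_iff[OF assms(3) \<open>C \<noteq> {}\<close>] by (intro sum_mono) blast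
  then show ?thesis
    by (simp add: card_color_class_eq_sum_fibers[OF assms(1,2,4)] sum.distrib mult.commute)
qed

text \<open>With slack 0 all colors of \<open>C\<close> occur equally often at each vertex. Some
  color occurs at every \<open>v\<close>, hence so does \<open>c\<close>, and the class of
  \<open>c\<close> maps onto \<open>V\<close>.\<close>

lemma zero_fair_surj_imp_card_le_color_class:
  assumes "finite U" "finite V" "finite C" "col ` U \<subseteq> C" "f ` U = V"
    and "\<forall>v\<in>V. fair_set C col 0 {u \<in> U. f u = v}" "c \<in> C"
  shows "card V \<le> card (color_class col U c)"
proof -
  have "V \<subseteq> f ` color_class col U c"
  proof
    fix v assume v: "v \<in> V"
    then obtain u where u: "u \<in> U" "f u = v" using assms(5) by blast
    let ?S = "\<lambda>x. color_class col {u \<in> U. f u = v} x"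
    have "C \<noteq> {}" using assms(7) by blast
    then have "card (?S (col u)) \<le> card (?S c)"
      using v u assms(4,6,7) fair_set_iff[OF assms(3), of col 0] by auto
    moreover have "u \<in> ?S (col u)" using u by (simp add: color_class_def)
    moreover have "finite (?S (col u))" using assms(1) by (simp add: color_class_def)
    ultimately have "card (?S c) \<noteq> 0" by (metis card_0_eq empty_iff le_zero_eq)
    then have "?S c \<noteq> {}" by force
    then show "v \<in> f ` color_class col U c" by (auto simp: color_class_def)
  qed
  then show ?thesis using assms(1) by (intro surj_card_le) (auto simp: color_class_def)
qed

section \<open>A fair surjection when all classes are small\<close>

lemma obtain_fair_surj:
  assumes "finite U" "finite V" "finite C" "C \<noteq> {}" "col ` U \<subseteq> C" "0 < l" "card V \<le> card U"
    and "\<And>c. c \<in> C \<Longrightarrow> card (color_class col U c) \<le> card V"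
  obtains f where "f ` U = V" "\<forall>v\<in>V. fair_set C col l {u \<in> U. f u = v}"
proof -
  \<comment> \<open>The bound is needed for every \<open>c\<close>, so colors outside
    \<open>C\<close> are covered too; their classes are empty.\<close>
  have le: "card (color_class col U c) \<le> card V" for c
  proof (cases "c \<in> C")
    case False
    then have "color_class col U c = {}" using assms(5) by (auto simp: color_class_def)
    then show ?thesis by simp
  qed (rule assms(8))
  obtain f where f: "f ` U = V" and inj: "\<And>c. inj_on f (color_class col U c)"
    using obtain_surj_inj_on_color_classes[OF assms(1,2,7) le] by blast
  have one: "card (color_class col {u \<in> U. f u = v} c) \<le> 1" for v c
  proof -
    have "finite (color_class col {u \<in> U. f u = v} c)" using assms(1) by (simp add: color_class_def)
    moreover have "x = y" if "x \<in> color_class col {u \<in> U. f u = v} c"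
      "y \<in> color_class col {u \<in> U. f u = v} c" for x y
      using that inj_onD[OF inj[of c], of x y] by (auto simp: color_class_def)
    ultimately show ?thesis by (simp add: card_le_Suc0_iff_eq)
  qed
  \<comment> \<open>Counts are 0 or 1, so two of them differ by at most 1, hence by at most
    \<open>l\<close>.\<close>
  have "card (color_class col {u \<in> U. f u = v} c) \<le>
      card (color_class col {u \<in> U. f u = v} d) + l" for v c d
    using assms(6) one[of v c] by linarith
  with f that show thesis by (simp add: fair_set_iff[OF assms(3,4)])
qed

section \<open>The two equivalences\<close>

theorem theorem27:
  fixes U V :: "'a set" and E :: "'a set set"
    and C :: "'c set" and col :: "'a \<Rightarrow> 'c" and l n k :: nat
    and c :: "nat \<Rightarrow> 'c"
  assumes "mmfm_instance U V E C col"
    and "complete_bipartite_graph U V E"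
    and "C \<noteq> {}"
    and "U \<noteq> {} \<longrightarrow> V \<noteq> {}"
    and "n = card U" and "k = card V"
    and "bij_betw c {1..card C} C"
    and "\<forall>i\<in>{1..card C - 1}.
           card (color_class col U (c i)) \<ge> card (color_class col U (c (i + 1)))"
  shows "(mmfm_yes U V E C col l \<longleftrightarrow>
            card (color_class col U (c 1)) \<le> l * k + card (color_class col U (c (card C))))
       \<and> (mmfm_yes_nonempty U V E C col l \<longleftrightarrow>
            card (color_class col U (c 1)) \<le> l * k + card (color_class col U (c (card C)))
            \<and> ((l > 0 \<and> n \<ge> k) \<or> (l = 0 \<and> card (color_class col U (c 1)) \<ge> k)))"
proof -
  let ?a = "\<lambda>x. card (color_class col U x)"
  let ?hi = "?a (c 1)" and ?lo = "?a (c (card C))"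
  have fin: "finite U" "finite V" "finite C" and colU: "col ` U \<subseteq> C"
    using assms(1) by (auto simp: mmfm_instance_def bipartite_graph_def)
  have C0: "card C \<ge> 1" using fin assms(3) by (simp add: Suc_leI card_gt_0_iff)
  then have c1: "c 1 \<in> C" and cC: "c (card C) \<in> C"
    using assms(7) by (auto simp: bij_betw_def)
  have anti: "?a (c j) \<le> ?a (c i)" if "1 \<le> i" "i \<le> j" "j \<le> card C" for i j
    using that(2,3)
  proof (induction j rule: dec_induct)
    case (step m)
    then have "m \<in> {1..card C - 1}" using that(1) by auto
    then show ?case using assms(8) step by fastforce
  qed simp
  \<comment> \<open>The extreme sizes occur at \<open>c 1\<close> and \<open>c (card C)\<close>, so
    the one inequality between them implies the inequality for all pairs of colors.\<close>
  have range: "?a x \<le> ?hi" "?lo \<le> ?a x" if x: "x \<in> C" for x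
  proof -
    obtain i where "i \<in> {1..card C}" "x = c i"
      using x bij_betw_imp_surj_on[OF assms(7)] by blast
    then show "?a x \<le> ?hi" "?lo \<le> ?a x" using anti[of 1 i] anti[of i "card C"] by auto
  qed
  have nec: "?hi \<le> l * k + ?lo"
    if "f ` U \<subseteq> V" "\<forall>v\<in>V. fair_set C col l {u \<in> U. f u = v}" for f
    using fair_map_imp_card_bound[OF fin that c1 cC] assms(6) by simp
  \<comment> \<open>The final implication lets one map serve both variants.\<close>
  have suf: "\<exists>f. f ` U \<subseteq> V \<and> (\<forall>v\<in>V. fair_set C col l {u \<in> U. f u = v}) \<and>
      (k \<le> ?hi \<longrightarrow> f ` U = V)" if le: "?hi \<le> l * k + ?lo"
  \<comment> \<open>The cyclic map needs some vertex to send elements to. Without one,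
    \<open>U\<close> is empty as well and any \<open>f\<close> will do.\<close>
  proof (cases "V = {}")
    case True
    then show ?thesis using assms(4) by simp
  next
    case False
    have le': "?a x \<le> l * card V + ?a y" if "x \<in> C" "y \<in> C" for x y
      using range(1)[OF that(1)] range(2)[OF that(2)] le assms(6) by simp
    obtain f where "f ` U \<subseteq> V" "\<forall>v\<in>V. fair_set C col l {u \<in> U. f u = v}"
      "\<And>x. card V \<le> ?a x \<Longrightarrow> f ` U = V"
      using obtain_cyclic_fair_map[OF fin(1,2) False fin(3) assms(3) le'] by blast
    then show ?thesis using assms(6) by blast
  qed
  have "mmfm_yes U V E C col l \<longleftrightarrow> ?hi \<le> l * k + ?lo"
    unfolding mmfm_yes_iff_map[OF assms(2)]
  proof
    assume "\<exists>f. f ` U \<subseteq> V \<and> (\<forall>v\<in>V. fair_set C col l {u \<in> U. f u = v})"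
    then show "?hi \<le> l * k + ?lo" by (elim exE conjE) (rule nec)
  next
    assume "?hi \<le> l * k + ?lo"
    from suf[OF this] show "\<exists>f. f ` U \<subseteq> V \<and> (\<forall>v\<in>V. fair_set C col l {u \<in> U. f u = v})"
      by (elim exE conjE) (intro exI conjI)
  qed
  moreover have "mmfm_yes_nonempty U V E C col l \<longleftrightarrow>
    ?hi \<le> l * k + ?lo \<and> ((l > 0 \<and> n \<ge> k) \<or> (l = 0 \<and> ?hi \<ge> k))"
    unfolding mmfm_yes_nonempty_iff_map[OF assms(2)]
  proof
    assume "\<exists>f. f ` U = V \<and> (\<forall>v\<in>V. fair_set C col l {u \<in> U. f u = v})"
    then obtain f where f: "f ` U = V" "\<forall>v\<in>V. fair_set C col l {u \<in> U. f u = v}" by blast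
    have "k \<le> n" using card_image_le[OF fin(1), of f] f(1) assms(5,6) by simp
    moreover have "k \<le> ?hi" if "l = 0"
      using zero_fair_surj_imp_card_le_color_class[OF fin colU f(1) _ c1] f(2) that assms(6)
      by simp
    moreover have "?hi \<le> l * k + ?lo" using nec[of f] f by simp
    ultimately show "?hi \<le> l * k + ?lo \<and> ((l > 0 \<and> n \<ge> k) \<or> (l = 0 \<and> ?hi \<ge> k))"
      by (cases "l = 0") simp_all
  next
    assume R: "?hi \<le> l * k + ?lo \<and> ((l > 0 \<and> n \<ge> k) \<or> (l = 0 \<and> ?hi \<ge> k))"
    show "\<exists>f. f ` U = V \<and> (\<forall>v\<in>V. fair_set C col l {u \<in> U. f u = v})"
    \<comment> \<open>The split is by the size of the largest class and not by \<open>l\<close>: a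
      class of size at least \<open>k\<close> makes the cyclic map onto even for
      \<open>l = 0\<close>.\<close>
    proof (cases "k \<le> ?hi")
      case True
      then obtain f where "f ` U = V" "\<forall>v\<in>V. fair_set C col l {u \<in> U. f u = v}"
        using suf[OF conjunct1[OF R]] by (elim exE conjE) simp
      then show ?thesis by (intro exI conjI)
    next
      case False
      \<comment> \<open>The alternative with \<open>l = 0\<close> is excluded, as it demands
        \<open>k \<le> ?hi\<close>.\<close>
      then have l: "l > 0" and VU: "card V \<le> card U" using R assms(5,6) by auto
      have "?a x \<le> card V" if "x \<in> C" for x
        using range(1)[OF that] False assms(6) by simp
      then obtain f where "f ` U = V" "\<forall>v\<in>V. fair_set C col l {u \<in> U. f u = v}"
        using obtain_fair_surj[OF fin assms(3) colU l VU] by metis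
      then show ?thesis by (intro exI conjI)
    qed
  qed
  ultimately show ?thesis by (rule conjI)
qed

end
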